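(* Let $(X,d)$ be a metric space and let $\mathcal{S}$ be a bornology on $X$. If $\mathcal{S}$ is stable under Lipschitz enlargements, then $\tau_{\mathcal{S},d}^+=\mathsf{G}_{\mathcal{S},d}^+$ and $\tau_{\mathcal{S},d}^-=\mathcal{LE}_{\mathcal{S},d}^-$ on $CL(X)$.
   Context: A bornology on a metric space $(X,d)$ is a nonempty family $\mathcal{S}$ of nonempty subsets of $X$ that is hereditary (nonempty subsets of members are members), stable under finite unions, and covers $X$. $CL(X)$ is the collection of all nonempty closed subsets of $X$. $d(x,A)=\inf_{a\in A}d(x,a)$; $B_d(x,r)$ is the open ball of radius $r$. $\mathcal{S}$ is stable under Lipschitz enlargements if $B_d(S,f):=\bigcup_{x\in S}B_d(x,f(x))\in\mathcal{S}$ for every $S\in\mathcal{S}$ and every Lipschitz function $f:X\to\mathbb{R}$ with $f(x)>0$ for all $x\in X$. Gap: $D_d(S,A)=\inf\{d(x,a):x\in S,\ a\in A\}$. Excess: $e_d(S,A)=\sup_{x\in S}d(x,A)\in[0,\infty]$. The upper gap convergence $\mathsf{G}_{\mathcal{S},d}^+$ is convergence in the weakest topology on $CL(X)$ for which each $D_d(S,\cdot)$, $S\in\mathcal{S}$, is lower semicontinuous. The lower left excess convergence $\mathcal{LE}_{\mathcal{S},d}^-$ is convergence in the weakest topology on $CL(X)$ for which each $e_d(S,\cdot)$, $S\in\mathcal{S}$, is upper semicontinuous. A net $(A_\lambda)$ is $\tau_{\mathcal{S},d}^-$-convergent (resp. $\tau_{\mathcal{S},d}^+$-convergent) to $A$ if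 for every $\epsilon>0$ and $S\in\mathcal{S}$, eventually $d(x,A_\lambda)-d(x,A)<\epsilon$ (resp. $d(x,A)-d(x,A_\lambda)<\epsilon$) for all $x\in S$; these are the convergences of topologies denoted by the same symbols. Equality of two convergences on $CL(X)$ means that they have the same convergent nets in $CL(X)$ with the same limits in $CL(X)$. *)

theory Defs
  imports "HOL-Analysis.Analysis"
begin

text \<open>The metric space \<open>(X, d)\<close> is a type of class \<^class>\<open>metric_space\<close> with \<open>d = dist\<close>.
  A bornology consists of nonempty sets and covers \<open>X\<close>, so \<open>X\<close> being nonempty is no restriction.\<close>

definition bornology :: "'a set set \<Rightarrow> bool" where
  "bornology \<S> \<longleftrightarrow>
     \<S> \<noteq> {} \<and> {} \<notin> \<S> \<and>
     (\<forall>S\<in>\<S>. \<forall>T. T \<subseteq> S \<and> T \<noteq> {} \<longrightarrow> T \<in> \<S>) \<and>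
     (\<forall>\<F>. finite \<F> \<and> \<F> \<noteq> {} \<and> \<F> \<subseteq> \<S> \<longrightarrow> \<Union>\<F> \<in> \<S>) \<and>
     \<Union>\<S> = UNIV"

definition enlargement :: "'a::metric_space set \<Rightarrow> ('a \<Rightarrow> real) \<Rightarrow> 'a set" where
  "enlargement S f = (\<Union>x\<in>S. ball x (f x))"

definition stable_under_Lipschitz_enlargements :: "'a::metric_space set set \<Rightarrow> bool" where
  "stable_under_Lipschitz_enlargements \<S> \<longleftrightarrow>
     (\<forall>S\<in>\<S>. \<forall>f. (\<exists>L. L-lipschitz_on UNIV f) \<and> (\<forall>x. 0 < f x) \<longrightarrow> enlargement S f \<in> \<S>)"

definition CL :: "'a::topological_space set set" where
  "CL = {A. closed A \<and> A \<noteq> {}}"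

text \<open>The gap is \<^const>\<open>setdist\<close> and \<open>d(x, A)\<close> is \<^const>\<open>infdist\<close>; their special values at
  the empty set are never used, since members of a bornology and of \<^const>\<open>CL\<close> are nonempty.\<close>

definition excess :: "'a::metric_space set \<Rightarrow> 'a set \<Rightarrow> ennreal" where
  "excess S A = (SUP x\<in>S. ennreal (infdist x A))"


definition lower_semicontinuous_map :: "'b topology \<Rightarrow> ('b \<Rightarrow> 'c::linorder) \<Rightarrow> bool" where
  "lower_semicontinuous_map T f \<longleftrightarrow> (\<forall>\<alpha>. openin T {x \<in> topspace T. \<alpha> < f x})"

definition upper_semicontinuous_map :: "'b topology \<Rightarrow> ('b \<Rightarrow> 'c::linorder) \<Rightarrow> bool" where
  "upper_semicontinuous_map T f \<longleftrightarrow> (\<forall>\<alpha>. openin T {x \<in> topspace T. f x < \<alpha>})"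

text \<open>The intersection of all topologies on \<open>C\<close> with property \<open>P\<close>. It is the weakest such
  topology whenever it has property \<open>P\<close> itself, which is shown below for the two uses made of it.\<close>

definition weakest_topology_on :: "'b set \<Rightarrow> ('b topology \<Rightarrow> bool) \<Rightarrow> 'b topology" where
  "weakest_topology_on C P =
     topology (\<lambda>U. U \<subseteq> C \<and> (\<forall>T. topspace T = C \<and> P T \<longrightarrow> openin T U))"

lemma openin_weakest_topology_on:
  "openin (weakest_topology_on C P) U \<longleftrightarrow>
     U \<subseteq> C \<and> (\<forall>T. topspace T = C \<and> P T \<longrightarrow> openin T U)"
proof -
  have "istopology (\<lambda>U. U \<subseteq> C \<and> (\<forall>T. topspace T = C \<and> P T \<longrightarrow> openin T U))"
    unfolding istopology_def by (auto intro!: openin_Union)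
  then show ?thesis
    by (simp add: weakest_topology_on_def)
qed

lemma topspace_weakest_topology_on [simp]: "topspace (weakest_topology_on C P) = C"
proof -
  have "openin (weakest_topology_on C P) C"
    using openin_topspace by (auto simp: openin_weakest_topology_on)
  then show ?thesis
    by (metis openin_subset openin_topspace openin_weakest_topology_on subset_antisym)
qed

definition upper_gap_topology :: "'a::metric_space set set \<Rightarrow> 'a set topology" where
  "upper_gap_topology \<S> =
     weakest_topology_on CL (\<lambda>T. \<forall>S\<in>\<S>. lower_semicontinuous_map T (setdist S))"

definition lower_left_excess_topology :: "'a::metric_space set set \<Rightarrow> 'a set topology" where
  "lower_left_excess_topology \<S> =
     weakest_topology_on CL (\<lambda>T. \<forall>S\<in>\<S>. upper_semicontinuous_map T (excess S))"

lemma lower_semicontinuous_map_upper_gap_topology: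
  "S \<in> \<S> \<Longrightarrow> lower_semicontinuous_map (upper_gap_topology \<S>) (setdist S)"
  by (auto simp: lower_semicontinuous_map_def upper_gap_topology_def openin_weakest_topology_on)

lemma upper_semicontinuous_map_lower_left_excess_topology:
  "S \<in> \<S> \<Longrightarrow> upper_semicontinuous_map (lower_left_excess_topology \<S>) (excess S)"
  by (auto simp: upper_semicontinuous_map_def lower_left_excess_topology_def
      openin_weakest_topology_on)


text \<open>A net is a function on a set \<open>D\<close> directed by a preorder; convergence of the net is
  convergence along the filter of tails of \<open>D\<close>.\<close>

definition directed_by :: "'i set \<Rightarrow> ('i \<Rightarrow> 'i \<Rightarrow> bool) \<Rightarrow> bool" where
  "directed_by D le \<longleftrightarrow>
     D \<noteq> {} \<and> (\<forall>i\<in>D. le i i) \<and>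
     (\<forall>i\<in>D. \<forall>j\<in>D. \<forall>k\<in>D. le i j \<and> le j k \<longrightarrow> le i k) \<and>
     (\<forall>i\<in>D. \<forall>j\<in>D. \<exists>k\<in>D. le i k \<and> le j k)"

definition tails :: "'i set \<Rightarrow> ('i \<Rightarrow> 'i \<Rightarrow> bool) \<Rightarrow> 'i filter" where
  "tails D le = (INF i\<in>D. principal {j\<in>D. le i j})"

lemma eventually_tails:
  assumes "directed_by D le"
  shows "eventually P (tails D le) \<longleftrightarrow> (\<exists>i\<in>D. \<forall>j\<in>D. le i j \<longrightarrow> P j)"
proof -
  have "eventually P (tails D le) \<longleftrightarrow> (\<exists>i\<in>D. eventually P (principal {j\<in>D. le i j}))"
    unfolding tails_def
  proof (rule eventually_INF_base)
    show "D \<noteq> {}"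
      using assms by (simp add: directed_by_def)
  next
    fix a b assume ab: "a \<in> D" "b \<in> D"
    then obtain k where k: "k \<in> D" "le a k" "le b k"
      using assms unfolding directed_by_def by blast
    have "{j\<in>D. le k j} \<subseteq> {j\<in>D. le a j} \<inter> {j\<in>D. le b j}"
      using assms ab k unfolding directed_by_def by blast
    then show "\<exists>x\<in>D. principal {j\<in>D. le x j} \<le>
        inf (principal {j\<in>D. le a j}) (principal {j\<in>D. le b j})"
      using k by auto
  qed
  then show ?thesis
    by (auto simp: eventually_principal)
qed

definition tau_minus_convergent ::
    "'a::metric_space set set \<Rightarrow> ('i \<Rightarrow> 'a set) \<Rightarrow> 'a set \<Rightarrow> 'i filter \<Rightarrow> bool" where
  "tau_minus_convergent \<S> A L F \<longleftrightarrow>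
     (\<forall>\<epsilon>>0. \<forall>S\<in>\<S>. eventually (\<lambda>i. \<forall>x\<in>S. infdist x (A i) - infdist x L < \<epsilon>) F)"

definition tau_plus_convergent ::
    "'a::metric_space set set \<Rightarrow> ('i \<Rightarrow> 'a set) \<Rightarrow> 'a set \<Rightarrow> 'i filter \<Rightarrow> bool" where
  "tau_plus_convergent \<S> A L F \<longleftrightarrow>
     (\<forall>\<epsilon>>0. \<forall>S\<in>\<S>. eventually (\<lambda>i. \<forall>x\<in>S. infdist x L - infdist x (A i) < \<epsilon>) F)"

end

theory Submission
  imports Defs
begin

text \<open>Convergence in a weakest topology can be tested on the generating semicontinuous functions.
  Uniform convergence implies gap and excess convergence for any family of nonempty
  sets. For the converses, \<open>\<tau>\<^sup>+\<close> at \<open>S\<close> with tolerance \<open>\<epsilon>\<close> follows from the gap to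
  the enlargement of \<open>{x \<in> S. d(x, L) \<ge> \<epsilon>}\<close> by \<open>d(\<cdot>, L) - \<epsilon>/2\<close>, which stays \<open>\<epsilon>/2\<close> away from
  \<open>L\<close>; and \<open>\<tau>\<^sup>-\<close> follows from the excess of the part of \<open>L\<close> in the enlargement of \<open>S\<close> by
  \<open>d(\<cdot>, L) + \<epsilon>/2\<close>, since that part contains nearly closest points of \<open>L\<close> to all points of \<open>S\<close>.\<close>

section \<open>Distances, radius functions and bornologies\<close>

lemma le_infdist:
  assumes "A \<noteq> {}" and "\<And>a. a \<in> A \<Longrightarrow> c \<le> dist x a"
  shows "c \<le> infdist x A"
  unfolding infdist_notempty[OF assms(1)] using assms by (rule cINF_greatest)

text \<open>Covers the radius functions of both halves: \<open>c\<close> is negative for gaps and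
  positive for excesses.\<close>

lemma lipschitz_on_infdist_add: "1-lipschitz_on UNIV (\<lambda>x. infdist x A + c)"
  by (rule lipschitz_onI) (simp_all add: dist_real_def infdist_triangle_abs)

text \<open>Truncating from below makes a radius function positive everywhere at no cost in the
  Lipschitz constant, since \<open>max\<close> with a constant does not increase distances.\<close>

lemma lipschitz_on_max_const:
  fixes f :: "'a::metric_space \<Rightarrow> real"
  assumes "L-lipschitz_on U f"
  shows "L-lipschitz_on U (\<lambda>x. max (f x) c)"
proof (rule lipschitz_onI)
  fix x y assume "x \<in> U" "y \<in> U"
  have "dist (max (f x) c) (max (f y) c) \<le> dist (f x) (f y)"
    by (auto simp: dist_real_def max_def)
  also have "\<dots> \<le> L * dist x y"
    using assms \<open>x \<in> U\<close> \<open>y \<in> U\<close> by (rule lipschitz_onD)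
  finally show "dist (max (f x) c) (max (f y) c) \<le> L * dist x y" .
qed (rule lipschitz_on_nonneg[OF assms])

lemma bornology_subset:
  "bornology \<S> \<Longrightarrow> S \<in> \<S> \<Longrightarrow> T \<subseteq> S \<Longrightarrow> T \<noteq> {} \<Longrightarrow> T \<in> \<S>"
  unfolding bornology_def by blast

lemma enlargement_mem:
  assumes "stable_under_Lipschitz_enlargements \<S>" "S \<in> \<S>"
    and "L-lipschitz_on UNIV f" "\<And>x. 0 < f x"
  shows "enlargement S f \<in> \<S>"
  using assms unfolding stable_under_Lipschitz_enlargements_def by blast

lemma eventually_mem_tails:
  assumes "directed_by D le"
  shows "eventually (\<lambda>i. i \<in> D) (tails D le)"
  using assms unfolding eventually_tails[OF assms] directed_by_def by blast

section \<open>Convergence in the weakest topologies\<close>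

lemma istopology_eventually:
  "istopology (\<lambda>U. U \<subseteq> C \<and> (L \<in> U \<longrightarrow> eventually (\<lambda>i. A i \<in> U) F))"
proof -
  \<comment> \<open>A union containing \<open>L\<close> has a member containing \<open>L\<close>,
    and this single member already captures \<open>A\<close> eventually.\<close>
  have "eventually (\<lambda>i. A i \<in> \<Union>\<K>) F"
    if "U \<in> \<K>" "eventually (\<lambda>i. A i \<in> U) F" for U \<K>
    using that(2) by (rule eventually_mono) (use that(1) in blast)
  then show ?thesis
    unfolding istopology_def by (auto simp: eventually_conj_iff)
qed

text \<open>The finest topology on \<open>C\<close> in which \<open>A\<close> converges to \<open>L\<close> is used as a test topology.\<close>

lemma limitin_weakest_topology_onI:
  assumes "L \<in> C" and ev: "eventually (\<lambda>i. A i \<in> C) F"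
    and P: "\<And>T. topspace T = C \<Longrightarrow>
      (\<And>U. openin T U \<longleftrightarrow> U \<subseteq> C \<and> (L \<in> U \<longrightarrow> eventually (\<lambda>i. A i \<in> U) F)) \<Longrightarrow> P T"
  shows "limitin (weakest_topology_on C P) A L F"
proof -
  define T where "T = topology (\<lambda>U. U \<subseteq> C \<and> (L \<in> U \<longrightarrow> eventually (\<lambda>i. A i \<in> U) F))"
  have T: "openin T U \<longleftrightarrow> U \<subseteq> C \<and> (L \<in> U \<longrightarrow> eventually (\<lambda>i. A i \<in> U) F)" for U
    unfolding T_def by (simp add: istopology_eventually)
  have "topspace T = C"
  proof
    show "topspace T \<subseteq> C"
      using T openin_topspace by blast
    \<comment> \<open>Here the net has to lie in \<open>C\<close> eventually; otherwise
      \<open>C\<close> would not be open in \<open>T\<close>.\<close>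
    have "openin T C"
      using T ev by simp
    then show "C \<subseteq> topspace T"
      by (rule openin_subset)
  qed
  then have "P T"
    using T by (rule P)
  \<comment> \<open>\<open>T\<close> is one of the topologies being intersected, so it is finer than
    the weakest one.\<close>
  with \<open>topspace T = C\<close> have "openin T U" if "openin (weakest_topology_on C P) U" for U
    using that by (auto simp only: openin_weakest_topology_on)
  with T \<open>L \<in> C\<close> show ?thesis
    by (simp add: limitin_def)
qed

text \<open>Superlevel sets of the gap are open, which gives one direction. For the other, all
  points except \<open>L\<close> are isolated in the test topology, so semicontinuity has content
  only at \<open>L\<close>, where it is the stated condition.\<close>

lemma limitin_upper_gap_topology:
  assumes "L \<in> CL" and ev: "eventually (\<lambda>i. A i \<in> CL) F"
  shows "limitin (upper_gap_topology \<S>) A L F \<longleftrightarrow>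
    (\<forall>S\<in>\<S>. \<forall>\<alpha> < setdist S L. eventually (\<lambda>i. \<alpha> < setdist S (A i)) F)"
proof
  assume lim: "limitin (upper_gap_topology \<S>) A L F"
  show "\<forall>S\<in>\<S>. \<forall>\<alpha> < setdist S L. eventually (\<lambda>i. \<alpha> < setdist S (A i)) F"
  proof (intro ballI allI impI)
    fix S \<alpha> assume "S \<in> \<S>" and \<alpha>: "\<alpha> < setdist S L"
    then have "openin (upper_gap_topology \<S>) {B \<in> CL. \<alpha> < setdist S B}"
      using lower_semicontinuous_map_upper_gap_topology[of S \<S>]
      by (simp add: lower_semicontinuous_map_def upper_gap_topology_def)
    then have "eventually (\<lambda>i. A i \<in> {B \<in> CL. \<alpha> < setdist S B}) F"
      using lim \<alpha> \<open>L \<in> CL\<close> unfolding limitin_def by blast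
    then show "eventually (\<lambda>i. \<alpha> < setdist S (A i)) F"
      by (rule eventually_mono) simp
  qed
next
  assume "\<forall>S\<in>\<S>. \<forall>\<alpha> < setdist S L. eventually (\<lambda>i. \<alpha> < setdist S (A i)) F"
  then show "limitin (upper_gap_topology \<S>) A L F"
    unfolding upper_gap_topology_def
    using assms by (intro limitin_weakest_topology_onI)
      (auto simp: lower_semicontinuous_map_def eventually_conj_iff)
qed

text \<open>The same argument with sublevel sets. As \<alpha> is an \<open>ennreal\<close>, a set
  \<open>S\<close> of infinite excess over \<open>L\<close> imposes no condition.\<close>

lemma limitin_lower_left_excess_topology:
  assumes "L \<in> CL" and ev: "eventually (\<lambda>i. A i \<in> CL) F"
  shows "limitin (lower_left_excess_topology \<S>) A L F \<longleftrightarrow>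
    (\<forall>S\<in>\<S>. \<forall>\<alpha> > excess S L. eventually (\<lambda>i. excess S (A i) < \<alpha>) F)"
proof
  assume lim: "limitin (lower_left_excess_topology \<S>) A L F"
  show "\<forall>S\<in>\<S>. \<forall>\<alpha> > excess S L. eventually (\<lambda>i. excess S (A i) < \<alpha>) F"
  proof (intro ballI allI impI)
    fix S \<alpha> assume "S \<in> \<S>" and \<alpha>: "excess S L < \<alpha>"
    then have "openin (lower_left_excess_topology \<S>) {B \<in> CL. excess S B < \<alpha>}"
      using upper_semicontinuous_map_lower_left_excess_topology[of S \<S>]
      by (simp add: upper_semicontinuous_map_def lower_left_excess_topology_def)
    then have "eventually (\<lambda>i. A i \<in> {B \<in> CL. excess S B < \<alpha>}) F"
      using lim \<alpha> \<open>L \<in> CL\<close> unfolding limitin_def by blast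
    then show "eventually (\<lambda>i. excess S (A i) < \<alpha>) F"
      by (rule eventually_mono) simp
  qed
next
  assume "\<forall>S\<in>\<S>. \<forall>\<alpha> > excess S L. eventually (\<lambda>i. excess S (A i) < \<alpha>) F"
  then show "limitin (lower_left_excess_topology \<S>) A L F"
    unfolding lower_left_excess_topology_def
    using assms by (intro limitin_weakest_topology_onI)
      (auto simp: upper_semicontinuous_map_def eventually_conj_iff)
qed

section \<open>Upper convergence and gaps\<close>

lemma tau_plus_convergent_imp_gap:
  assumes "L \<noteq> {}" and ev: "eventually (\<lambda>i. A i \<noteq> {}) F"
    and tau: "tau_plus_convergent \<S> A L F" and "S \<in> \<S>" "S \<noteq> {}" and \<alpha>: "\<alpha> < setdist S L"
  shows "eventually (\<lambda>i. \<alpha> < setdist S (A i)) F"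
proof -
  \<comment> \<open>Half the difference leaves room: the infimum preserves only a weak bound, but
    \<open>setdist S L - \<epsilon>\<close> still exceeds \<alpha>.\<close>
  define \<epsilon> where "\<epsilon> = (setdist S L - \<alpha>) / 2"
  have "\<epsilon> > 0"
    using \<alpha> by (simp add: \<epsilon>_def)
  then have "eventually (\<lambda>i. \<forall>x\<in>S. infdist x L - infdist x (A i) < \<epsilon>) F"
    using tau \<open>S \<in> \<S>\<close> by (simp add: tau_plus_convergent_def)
  with ev show ?thesis
  proof eventually_elim
    fix i assume "A i \<noteq> {}" and less: "\<forall>x\<in>S. infdist x L - infdist x (A i) < \<epsilon>"
    have "setdist S L - \<epsilon> \<le> dist x a" if "x \<in> S" "a \<in> A i" for x a
    proof -
      have "setdist S L \<le> infdist x L"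
        using \<open>L \<noteq> {}\<close> \<open>x \<in> S\<close> by (intro le_infdist setdist_le_dist)
      moreover have "infdist x (A i) \<le> dist x a"
        using \<open>a \<in> A i\<close> by (rule infdist_le)
      ultimately show ?thesis
        using less \<open>x \<in> S\<close> by fastforce
    qed
    then have "setdist S L - \<epsilon> \<le> setdist S (A i)"
      using \<open>S \<noteq> {}\<close> \<open>A i \<noteq> {}\<close> by (intro le_setdistI)
    then show "\<alpha> < setdist S (A i)"
      using \<alpha> unfolding \<epsilon>_def by argo
  qed
qed

lemma gap_imp_tau_plus_convergent:
  assumes born: "bornology \<S>" and stable: "stable_under_Lipschitz_enlargements \<S>"
    and "L \<noteq> {}" and ev: "eventually (\<lambda>i. A i \<noteq> {}) F"
    and gap: "\<And>S \<alpha>. S \<in> \<S> \<Longrightarrow> \<alpha> < setdist S L \<Longrightarrow> eventually (\<lambda>i. \<alpha> < setdist S (A i)) F"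
  shows "tau_plus_convergent \<S> A L F"
  unfolding tau_plus_convergent_def
proof (intro allI impI ballI)
  fix \<epsilon> :: real and S assume "\<epsilon> > 0" "S \<in> \<S>"
  \<comment> \<open>Off \<open>S'\<close> the inequality holds because
    \<open>infdist x (A i)\<close> is nonnegative; on \<open>S'\<close> the radius
    \<open>infdist x L - \<epsilon> / 2\<close> is at least \<open>\<epsilon> / 2\<close>.\<close>
  define S' where "S' = {x \<in> S. \<epsilon> \<le> infdist x L}"
  have near: "infdist x L - infdist x (A i) < \<epsilon>" if "x \<in> S - S'" for x i
    using that infdist_nonneg[of x "A i"] by (auto simp: S'_def)
  show "eventually (\<lambda>i. \<forall>x\<in>S. infdist x L - infdist x (A i) < \<epsilon>) F"
  \<comment> \<open>Only nonempty subsets of \<open>S\<close> are inherited by the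
    bornology.\<close>
  proof (cases "S' = {}")
    case True
    then show ?thesis
      using near by simp
  next
    case False
    \<comment> \<open>the maximum only serves to make \<open>f\<close> positive outside \<open>S'\<close>\<close>
    define f where "f x = max (infdist x L + - (\<epsilon> / 2)) (\<epsilon> / 4)" for x
    define E where "E = enlargement S' f"
    have f: "f x = infdist x L - \<epsilon> / 2" if "x \<in> S'" for x
      using that \<open>\<epsilon> > 0\<close> by (auto simp: f_def S'_def)
    \<comment> \<open>The difference in \<open>f\<close> is written as a sum to match
      \<open>lipschitz_on_infdist_add\<close>.\<close>
    have "1-lipschitz_on UNIV f"
      unfolding f_def by (intro lipschitz_on_max_const lipschitz_on_infdist_add)
    moreover have pos: "0 < f x" for x
      using \<open>\<epsilon> > 0\<close> by (simp add: f_def less_max_iff_disj)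
    moreover have "S' \<in> \<S>"
      using born \<open>S \<in> \<S>\<close> _ False by (rule bornology_subset) (auto simp: S'_def)
    ultimately have "E \<in> \<S>"
      unfolding E_def using stable by (intro enlargement_mem)
    have "\<epsilon> / 2 \<le> dist y a" if "y \<in> E" "a \<in> L" for y a
    proof -
      obtain x where x: "x \<in> S'" "dist x y < f x"
        using \<open>y \<in> E\<close> by (auto simp: E_def enlargement_def)
      have "infdist x L \<le> dist x a"
        using \<open>a \<in> L\<close> by (rule infdist_le)
      also have "\<dots> \<le> dist x y + dist y a"
        by (rule dist_triangle)
      finally show ?thesis
        using x f by fastforce
    qed
    moreover have "E \<noteq> {}"
      using False pos by (auto simp: E_def enlargement_def not_le)
    ultimately have "\<epsilon> / 2 \<le> setdist E L"
      using \<open>L \<noteq> {}\<close> by (intro le_setdistI)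
    \<comment> \<open>The threshold \<open>0\<close> suffices: a positive gap makes
      \<open>A i\<close> miss \<open>E\<close>, hence every ball of radius \<open>f x\<close> around
      a point \<open>x\<close> of \<open>S'\<close>.\<close>
    then have "eventually (\<lambda>i. 0 < setdist E (A i)) F"
      using gap \<open>E \<in> \<S>\<close> \<open>\<epsilon> > 0\<close> by simp
    with ev show ?thesis
    proof eventually_elim
      fix i assume "A i \<noteq> {}" and "0 < setdist E (A i)"
      then have disj: "a \<notin> E" if "a \<in> A i" for a
        using that setdist_le_dist[of a E a "A i"] by auto
      have "infdist x L - \<epsilon> / 2 \<le> infdist x (A i)" if "x \<in> S'" for x
      proof (rule le_infdist)
        fix a assume "a \<in> A i"
        then have "\<not> dist x a < f x"
          using disj \<open>x \<in> S'\<close> by (auto simp: E_def enlargement_def)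
        then show "infdist x L - \<epsilon> / 2 \<le> dist x a"
          using f \<open>x \<in> S'\<close> by simp
      qed fact
      then have "infdist x L - infdist x (A i) < \<epsilon>" if "x \<in> S'" for x
        using that \<open>\<epsilon> > 0\<close> by fastforce
      then show "\<forall>x\<in>S. infdist x L - infdist x (A i) < \<epsilon>"
        using near by blast
    qed
  qed
qed

section \<open>Lower convergence and excesses\<close>

lemma tau_minus_convergent_imp_excess:
  assumes tau: "tau_minus_convergent \<S> A L F" and "S \<in> \<S>" and \<alpha>: "excess S L < \<alpha>"
  shows "eventually (\<lambda>i. excess S (A i) < \<alpha>) F"
proof -
  \<comment> \<open>The intermediate value is finite even if \<alpha> is infinite, and it absorbs
    the loss of strictness in the supremum.\<close>
  obtain b where b: "excess S L < b" "b < \<alpha>"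
    using dense \<alpha> by blast
  then obtain q where q: "b = ennreal q" "0 \<le> q"
    by (cases b) auto
  obtain r where r: "excess S L = ennreal r" "0 \<le> r"
    using b q by (cases "excess S L") auto
  have "r < q"
    using b q r by (simp add: ennreal_less_iff)
  then have "eventually (\<lambda>i. \<forall>x\<in>S. infdist x (A i) - infdist x L < q - r) F"
    using tau \<open>S \<in> \<S>\<close> by (simp add: tau_minus_convergent_def)
  then show ?thesis
  proof eventually_elim
    fix i assume less: "\<forall>x\<in>S. infdist x (A i) - infdist x L < q - r"
    have "infdist x (A i) \<le> q" if "x \<in> S" for x
    proof -
      have "ennreal (infdist x L) \<le> ennreal r"
        unfolding r(1)[symmetric] excess_def using \<open>x \<in> S\<close> by (rule SUP_upper)
      then show ?thesis
        using less \<open>x \<in> S\<close> r(2) by (fastforce simp: ennreal_le_iff)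
    qed
    then have "excess S (A i) \<le> b"
      unfolding excess_def q(1) by (intro SUP_least ennreal_leI)
    then show "excess S (A i) < \<alpha>"
      using b by order
  qed
qed

lemma excess_imp_tau_minus_convergent:
  assumes born: "bornology \<S>" and stable: "stable_under_Lipschitz_enlargements \<S>"
    and "L \<noteq> {}"
    and exc: "\<And>S \<alpha>. S \<in> \<S> \<Longrightarrow> excess S L < \<alpha> \<Longrightarrow> eventually (\<lambda>i. excess S (A i) < \<alpha>) F"
  shows "tau_minus_convergent \<S> A L F"
  unfolding tau_minus_convergent_def
proof (intro allI impI ballI)
  fix \<epsilon> :: real and S assume "\<epsilon> > 0" "S \<in> \<S>"
  \<comment> \<open>The summand \<open>\<epsilon> / 2\<close> keeps the radius positive on
    \<open>L\<close> and makes each ball around a point of \<open>S\<close> meet \<open>L\<close>,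
    even where the distance to \<open>L\<close> is not attained.\<close>
  define E where "E = enlargement S (\<lambda>x. infdist x L + \<epsilon> / 2)"
  have "E \<in> \<S>"
    unfolding E_def using stable \<open>S \<in> \<S>\<close> lipschitz_on_infdist_add
    by (rule enlargement_mem) (use \<open>\<epsilon> > 0\<close> in \<open>simp add: add_nonneg_pos infdist_nonneg\<close>)
  have close: "\<exists>t\<in>E \<inter> L. dist x t < infdist x L + \<epsilon> / 2" if "x \<in> S" for x
  proof -
    obtain t where "t \<in> L" "dist x t < infdist x L + \<epsilon> / 2"
      using le_infdist[OF \<open>L \<noteq> {}\<close>, of "infdist x L + \<epsilon> / 2" x] \<open>\<epsilon> > 0\<close> by force
    with \<open>x \<in> S\<close> show ?thesis
      by (force simp: E_def enlargement_def)
  qed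
  have "S \<noteq> {}"
    using born \<open>S \<in> \<S>\<close> by (auto simp: bornology_def)
  then have "E \<inter> L \<noteq> {}"
    using close by blast
  with born \<open>E \<in> \<S>\<close> Int_lower1 have "E \<inter> L \<in> \<S>"
    by (rule bornology_subset)
  \<comment> \<open>Being part of \<open>L\<close>, this set has zero excess over \<open>L\<close>
    even when that of \<open>S\<close> is infinite, so excess convergence yields a usable
    bound.\<close>
  moreover have "excess (E \<inter> L) L \<le> 0"
    unfolding excess_def by (intro SUP_least) simp
  then have "excess (E \<inter> L) L < ennreal (\<epsilon> / 2)"
    using \<open>\<epsilon> > 0\<close> by simp
  ultimately have "eventually (\<lambda>i. excess (E \<inter> L) (A i) < ennreal (\<epsilon> / 2)) F"
    by (rule exc)
  then show "eventually (\<lambda>i. \<forall>x\<in>S. infdist x (A i) - infdist x L < \<epsilon>) F"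
  proof eventually_elim
    fix i assume less: "excess (E \<inter> L) (A i) < ennreal (\<epsilon> / 2)"
    show "\<forall>x\<in>S. infdist x (A i) - infdist x L < \<epsilon>"
    proof
      fix x assume "x \<in> S"
      then obtain t where t: "t \<in> E \<inter> L" "dist x t < infdist x L + \<epsilon> / 2"
        using close by blast
      have "ennreal (infdist t (A i)) \<le> excess (E \<inter> L) (A i)"
        unfolding excess_def using t(1) by (rule SUP_upper)
      then have "infdist t (A i) < \<epsilon> / 2"
        using less by (metis ennreal_less_iff infdist_nonneg order_le_less_trans)
      \<comment> \<open>One \<open>\<epsilon> / 2\<close> is spent on going from \<open>x\<close> to
        \<open>t\<close>, the other on going from \<open>t\<close> to \<open>A i\<close>.\<close>
      moreover have "infdist x (A i) \<le> infdist t (A i) + dist x t"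
        by (rule infdist_triangle)
      ultimately show "infdist x (A i) - infdist x L < \<epsilon>"
        using t(2) by argo
    qed
  qed
qed

theorem theorem4p15:
  fixes \<S> :: "'a::metric_space set set"
  assumes "bornology \<S>"
    and "stable_under_Lipschitz_enlargements \<S>"
  shows "(\<forall>(D :: 'i set) le A L. directed_by D le \<and> A ` D \<subseteq> CL \<and> L \<in> CL \<longrightarrow>
            (tau_plus_convergent \<S> A L (tails D le) \<longleftrightarrow>
             limitin (upper_gap_topology \<S>) A L (tails D le))) \<and>
         (\<forall>(D :: 'i set) le A L. directed_by D le \<and> A ` D \<subseteq> CL \<and> L \<in> CL \<longrightarrow>
            (tau_minus_convergent \<S> A L (tails D le) \<longleftrightarrow>
             limitin (lower_left_excess_topology \<S>) A L (tails D le)))"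
proof (intro conjI allI impI; elim conjE)
  fix D :: "'i set" and le and A :: "'i \<Rightarrow> 'a set" and L :: "'a set"
  assume "directed_by D le" "A ` D \<subseteq> CL" "L \<in> CL"
  \<comment> \<open>\<open>A\<close> is constrained only on \<open>D\<close>, where the filter of
    tails is concentrated.\<close>
  have ev: "eventually (\<lambda>i. A i \<in> CL) (tails D le)"
    using eventually_mem_tails[OF \<open>directed_by D le\<close>]
    by (rule eventually_mono) (use \<open>A ` D \<subseteq> CL\<close> in blast)
  then have ne: "eventually (\<lambda>i. A i \<noteq> {}) (tails D le)"
    by (rule eventually_mono) (simp add: CL_def)
  have "L \<noteq> {}"
    using \<open>L \<in> CL\<close> by (simp add: CL_def)
  have S_ne: "S \<noteq> {}" if "S \<in> \<S>" for S
    using assms(1) that by (auto simp: bornology_def)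
  show "tau_plus_convergent \<S> A L (tails D le) \<longleftrightarrow>
      limitin (upper_gap_topology \<S>) A L (tails D le)"
    unfolding limitin_upper_gap_topology[OF \<open>L \<in> CL\<close> ev]
  proof (intro iffI ballI allI impI)
    show "eventually (\<lambda>i. \<alpha> < setdist S (A i)) (tails D le)"
      if "tau_plus_convergent \<S> A L (tails D le)" "S \<in> \<S>" "\<alpha> < setdist S L" for S \<alpha>
      using \<open>L \<noteq> {}\<close> ne that(1,2) S_ne[OF that(2)] that(3) by (rule tau_plus_convergent_imp_gap)
  qed (rule gap_imp_tau_plus_convergent[OF assms \<open>L \<noteq> {}\<close> ne], simp)
  show "tau_minus_convergent \<S> A L (tails D le) \<longleftrightarrow>
      limitin (lower_left_excess_topology \<S>) A L (tails D le)"
    unfolding limitin_lower_left_excess_topology[OF \<open>L \<in> CL\<close> ev]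
  proof (intro iffI ballI allI impI)
    show "eventually (\<lambda>i. excess S (A i) < \<alpha>) (tails D le)"
      if "tau_minus_convergent \<S> A L (tails D le)" "S \<in> \<S>" "excess S L < \<alpha>" for S \<alpha>
      using that by (rule tau_minus_convergent_imp_excess)
  qed (rule excess_imp_tau_minus_convergent[OF assms \<open>L \<noteq> {}\<close>], simp)
qed

end
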